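(* Let $\mathcal{G}$ and $\mathbf{g}$ be dual deformations of the Lie group $SL(2)$ and the Lie algebra $sl(2)$, with $D$-functions $\mathcal{D}^{\,j}_{m',m}\in\mathcal{G}$ and Clebsch-Gordan coefficients $\Omega$, $\mho$, as described in the context. Then for all spins $j_1,j_2$, all spins $j,j'\in\{|j_1-j_2|,|j_1-j_2|+1,\dots,j_1+j_2\}$ and all $m\in\{-j,\dots,j\}$, $m'\in\{-j',\dots,j'\}$, $$\delta_{j,j'}\,\mathcal{D}^{\,j}_{m',m}=\sum_{k_1,k_2,m_1,m_2}\mho^{j_1,j_2,j'}_{k_1,k_2,m'}\;\Omega^{j_1,j_2,j}_{m_1,m_2,m}\;\mathcal{D}^{\,j_1}_{k_1,m_1}\,\mathcal{D}^{\,j_2}_{k_2,m_2},$$ where $k_i,m_i$ run over $\{-j_i,-j_i+1,\dots,j_i\}$ for $i=1,2$.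
   Context: Setting. $\mathcal{G}$ (a deformation of the function algebra of $SL(2)$) and $\mathbf{g}$ (a deformation of the enveloping algebra of $sl(2)$) are Hopf algebras in duality. There are bases $\{x^\alpha\}$ of $\mathcal{G}$ and $\{X_\alpha\}$ of $\mathbf{g}$ and structure constants $h^{\alpha,\beta}_\gamma$, $f^\gamma_{\alpha,\beta}$ such that $$x^\alpha x^\beta=\sum_\gamma h^{\alpha,\beta}_\gamma x^\gamma,\quad X_\alpha X_\beta=\sum_\gamma f^\gamma_{\alpha,\beta}X_\gamma,\quad \Delta(x^\alpha)=\sum_{\beta,\gamma}f^\alpha_{\beta,\gamma}\,x^\beta\otimes x^\gamma,\quad \Delta(X_\alpha)=\sum_{\beta,\gamma}h^{\beta,\gamma}_\alpha X_\beta\otimes X_\gamma .$$ The universal $T$-matrix is $\mathcal{T}=\sum_\alpha x^\alpha\otimes X_\alpha$ (sums over $\alpha$ are understood formally). Assumptions on representations. $\mathbf{g}$ has the same finite dimensional highest weight irreducible representations as $sl(2)$: each is labelled by a spin $j\in\{0,\frac12,1,\dots\}$ with basis $|jm\rangle$, $m=-j,-j+1,\dots,j$, which is complete and orthonormal (with dual basis $\langle jm|$), and the tensor product of the irreducible representations $j_1$ and $j_2$ is completely reducible: $j_1\otimes j_2=(j_1+j_2)\oplus(j_1+j_2-1)\oplus\cdots\oplus|j_1-j_2|$. $D$-functions: $\mathcal{D}^{\,j}_{m',m}=\langle jm'|\mathcal{T}|jm\rangle=\sum_\alpha x^\alpha\,\langle jm'|X_\alpha|jm\rangle\in\mathcal{G}$.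 Clebsch-Gordan coefficients: $|(j_1j_2)jm\rangle$ denotes the vector of the spin-$j$ component of $j_1\otimes j_2$ corresponding to $|jm\rangle$ (so that $\mathbf{g}$, acting through its coproduct, acts on the $|(j_1j_2)jm\rangle$ by the same matrices as on the $|jm\rangle$). The coefficients $\Omega$ and their inverses $\mho$ are defined by $$|(j_1j_2)jm\rangle=\sum_{m_1,m_2}\Omega^{j_1,j_2,j}_{m_1,m_2,m}\,|j_1m_1\rangle\otimes|j_2m_2\rangle,\qquad |j_1m_1\rangle\otimes|j_2m_2\rangle=\sum_{j,m}\mho^{j_1,j_2,j}_{m_1,m_2,m}\,|(j_1j_2)jm\rangle .$$ *)

theory Defs
  imports Complex_Main
begin

section \<open>Algebras and tensor products over a field\<close>

locale assoc_algebra = vector_space scale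
  for scale :: "'k::field \<Rightarrow> 'a::ring_1 \<Rightarrow> 'a" +
  assumes scale_mult_left: "scale c a * b = scale c (a * b)"
    and scale_mult_right: "a * scale c b = scale c (a * b)"

definition bilinear_map ::
  "('k::field \<Rightarrow> 'a::ab_group_add \<Rightarrow> 'a) \<Rightarrow> ('k \<Rightarrow> 'b::ab_group_add \<Rightarrow> 'b) \<Rightarrow>
   ('k \<Rightarrow> 'c::ab_group_add \<Rightarrow> 'c) \<Rightarrow> ('a \<Rightarrow> 'b \<Rightarrow> 'c) \<Rightarrow> bool"
  where "bilinear_map s1 s2 s3 t \<longleftrightarrow>
    (\<forall>a. Vector_Spaces.linear s2 s3 (t a)) \<and> (\<forall>b. Vector_Spaces.linear s1 s3 (\<lambda>a. t a b))"

text \<open>The type \<open>'c\<close> is the algebraic tensor product of \<open>'a\<close> and \<open>'b\<close>, with \<open>t a b\<close> the pure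
  tensor: pure tensors span, and independent sets \<open>A\<close> and \<open>B\<close> give an independent family of
  pure tensors indexed by \<open>A \<times> B\<close>.\<close>

locale tensor_product =
  A: vector_space s1 + B: vector_space s2 + C: vector_space s3
  for s1 :: "'k::field \<Rightarrow> 'a::ab_group_add \<Rightarrow> 'a"
    and s2 :: "'k \<Rightarrow> 'b::ab_group_add \<Rightarrow> 'b"
    and s3 :: "'k \<Rightarrow> 'c::ab_group_add \<Rightarrow> 'c" +
  fixes t :: "'a \<Rightarrow> 'b \<Rightarrow> 'c"
  assumes bilinear: "bilinear_map s1 s2 s3 t"
    and spanning: "C.span {t a b |a b. True} = UNIV"
    and inj_on_basis: "\<not> A.dependent S \<Longrightarrow> \<not> B.dependent T \<Longrightarrow>
      inj_on (\<lambda>(a, b). t a b) (S \<times> T)"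
    and independent_basis: "\<not> A.dependent S \<Longrightarrow> \<not> B.dependent T \<Longrightarrow>
      \<not> C.dependent ((\<lambda>(a, b). t a b) ` (S \<times> T))"

definition (in vector_space) internal_direct_sum :: "'j set \<Rightarrow> ('j \<Rightarrow> 'b set) \<Rightarrow> 'b set \<Rightarrow> bool"
  where "internal_direct_sum J U W \<longleftrightarrow>
    (\<forall>j\<in>J. subspace (U j) \<and> U j \<subseteq> W) \<and>
    (\<forall>w\<in>W. \<exists>!u. (\<forall>j\<in>J. u j \<in> U j) \<and> (\<forall>j. j \<notin> J \<longrightarrow> u j = 0) \<and> w = (\<Sum>j\<in>J. u j))"


section \<open>Formal sums\<close>

text \<open>\<open>formal_sum p e c a\<close> states that \<open>a = \<Sum>\<^sub>i c\<^sub>i e\<^sub>i\<close> as a formal, possibly infinite, sum: when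
  both sides are paired with any test object \<open>Y\<close>, the sum becomes finite and agrees with
  \<open>p a Y\<close>.\<close>

definition formal_sum ::
  "('a \<Rightarrow> 'y \<Rightarrow> 'k::field) \<Rightarrow> ('i \<Rightarrow> 'a) \<Rightarrow> ('i \<Rightarrow> 'k) \<Rightarrow> 'a \<Rightarrow> bool"
  where "formal_sum p e c a \<longleftrightarrow>
    (\<forall>Y. finite {i. c i * p (e i) Y \<noteq> 0} \<and>
         p a Y = (\<Sum>i | c i * p (e i) Y \<noteq> 0. c i * p (e i) Y))"


section \<open>Hopf algebras with a basis\<close>

text \<open>A Hopf algebra with basis \<open>X\<close> and structure constants
  \<open>X\<^sub>\<alpha> X\<^sub>\<beta> = \<Sum>\<^sub>\<gamma> f \<alpha> \<beta> \<gamma> X\<^sub>\<gamma>\<close> and \<open>\<Delta> X\<^sub>\<alpha> = \<Sum> h \<beta> \<gamma> \<alpha> X\<^sub>\<beta> \<otimes> X\<^sub>\<gamma>\<close>.\<close>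

locale hopf_algebra_with_basis =
  alg: assoc_algebra scale + alg2: assoc_algebra scale2 +
  tensor_product scale scale scale2 tens
  for scale :: "'k::field \<Rightarrow> 'g::ring_1 \<Rightarrow> 'g"
    and scale2 :: "'k \<Rightarrow> 'gg::ring_1 \<Rightarrow> 'gg"
    and tens :: "'g \<Rightarrow> 'g \<Rightarrow> 'gg" +
  fixes comult :: "'g \<Rightarrow> 'gg" and counit :: "'g \<Rightarrow> 'k" and antipode :: "'g \<Rightarrow> 'g"
    and X :: "'i \<Rightarrow> 'g"
    and f :: "'i \<Rightarrow> 'i \<Rightarrow> 'i \<Rightarrow> 'k" and h :: "'i \<Rightarrow> 'i \<Rightarrow> 'i \<Rightarrow> 'k"
  assumes tens_mult: "tens a b * tens c d = tens (a * c) (b * d)"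
    and tens_one: "tens 1 1 = 1"
    and comult_linear: "Vector_Spaces.linear scale scale2 comult"
    and comult_mult: "comult (a * b) = comult a * comult b"
    and comult_one: "comult 1 = 1"
    and counit_linear: "Vector_Spaces.linear scale (*) counit"
    and counit_mult: "counit (a * b) = counit a * counit b"
    and counit_one: "counit 1 = 1"
    and antipode_linear: "Vector_Spaces.linear scale scale antipode"
    and basis_inj: "inj X"
    and basis_independent: "\<not> alg.dependent (range X)"
    and basis_span: "alg.span (range X) = UNIV"
    and f_finite: "finite {\<gamma>. f \<alpha> \<beta> \<gamma> \<noteq> 0}"
    and mult_basis: "X \<alpha> * X \<beta> = (\<Sum>\<gamma> | f \<alpha> \<beta> \<gamma> \<noteq> 0. scale (f \<alpha> \<beta> \<gamma>) (X \<gamma>))"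
    and h_finite: "finite {(\<beta>, \<gamma>). h \<beta> \<gamma> \<alpha> \<noteq> 0}"
    and comult_basis: "comult (X \<alpha>) =
      (\<Sum>(\<beta>, \<gamma>)\<in>{(\<beta>, \<gamma>). h \<beta> \<gamma> \<alpha> \<noteq> 0}. scale2 (h \<beta> \<gamma> \<alpha>) (tens (X \<beta>) (X \<gamma>)))"
    \<comment> \<open>the coefficients of \<open>X\<^sub>\<kappa> \<otimes> X\<^sub>\<mu> \<otimes> X\<^sub>\<nu>\<close> in \<open>(\<Delta> \<otimes> id) \<Delta> X\<^sub>\<alpha>\<close> and \<open>(id \<otimes> \<Delta>) \<Delta> X\<^sub>\<alpha>\<close>\<close>
    and coassoc: "(\<Sum>\<beta> | h \<beta> \<nu> \<alpha> \<noteq> 0. h \<beta> \<nu> \<alpha> * h \<kappa> \<mu> \<beta>) =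
      (\<Sum>\<beta> | h \<kappa> \<beta> \<alpha> \<noteq> 0. h \<kappa> \<beta> \<alpha> * h \<mu> \<nu> \<beta>)"
    and counit_left:
      "(\<Sum>(\<beta>, \<gamma>)\<in>{(\<beta>, \<gamma>). h \<beta> \<gamma> \<alpha> \<noteq> 0}. scale (h \<beta> \<gamma> \<alpha> * counit (X \<beta>)) (X \<gamma>)) = X \<alpha>"
    and counit_right:
      "(\<Sum>(\<beta>, \<gamma>)\<in>{(\<beta>, \<gamma>). h \<beta> \<gamma> \<alpha> \<noteq> 0}. scale (h \<beta> \<gamma> \<alpha> * counit (X \<gamma>)) (X \<beta>)) = X \<alpha>"
    and antipode_left:
      "(\<Sum>(\<beta>, \<gamma>)\<in>{(\<beta>, \<gamma>). h \<beta> \<gamma> \<alpha> \<noteq> 0}. scale (h \<beta> \<gamma> \<alpha>) (antipode (X \<beta>) * X \<gamma>)) =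
        scale (counit (X \<alpha>)) 1"
    and antipode_right:
      "(\<Sum>(\<beta>, \<gamma>)\<in>{(\<beta>, \<gamma>). h \<beta> \<gamma> \<alpha> \<noteq> 0}. scale (h \<beta> \<gamma> \<alpha>) (X \<beta> * antipode (X \<gamma>))) =
        scale (counit (X \<alpha>)) 1"


section \<open>Hopf algebras in duality\<close>

text \<open>\<open>'G\<close> is the deformed function algebra and \<open>'g\<close> the deformed enveloping algebra. The latter
  is a Hopf algebra in the plain algebraic sense. Sums over the basis of \<open>'G\<close> are formal,
  i.e. they are tested against \<open>'g\<close>. So \<open>'G\<close> may be the full linear dual of \<open>'g\<close>, the linear
  span of the \<open>x\<^sup>\<alpha>\<close> when this is closed under the operations, or anything in between. In
  particular \<open>x\<close> is a basis in this formal sense: every \<open>a\<close> is the unique formal sum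
  \<open>\<Sum>\<^sub>\<alpha> \<langle>a, X\<^sub>\<alpha>\<rangle> x\<^sup>\<alpha>\<close>, by \<open>dual_bases\<close> and \<open>nondegenerate\<close>.

  The coproduct of \<open>'G\<close> takes values in the completed tensor square, whose elements are
  represented by bilinear forms on \<open>'g\<close>; thus \<open>x\<^sup>\<beta> \<otimes> x\<^sup>\<gamma>\<close> is the form
  \<open>(Y, Z) \<mapsto> \<langle>x\<^sup>\<beta>, Y\<rangle> \<langle>x\<^sup>\<gamma>, Z\<rangle>\<close>. The Hopf algebra axioms of \<open>'G\<close> are the transposes of those of
  \<open>'g\<close> and hold because the pairing is nondegenerate.\<close>

locale dual_hopf_algebras =
  G: assoc_algebra scale_G +
  g: hopf_algebra_with_basis scale_g scale_gg tens comult counit antipode X f h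
  for scale_G :: "'k::field \<Rightarrow> 'G::ring_1 \<Rightarrow> 'G"
    and scale_g :: "'k \<Rightarrow> 'g::ring_1 \<Rightarrow> 'g"
    and scale_gg :: "'k \<Rightarrow> 'gg::ring_1 \<Rightarrow> 'gg"
    and tens :: "'g \<Rightarrow> 'g \<Rightarrow> 'gg"
    and comult :: "'g \<Rightarrow> 'gg" and counit :: "'g \<Rightarrow> 'k" and antipode :: "'g \<Rightarrow> 'g"
    and X :: "'i \<Rightarrow> 'g"
    and f :: "'i \<Rightarrow> 'i \<Rightarrow> 'i \<Rightarrow> 'k" and h :: "'i \<Rightarrow> 'i \<Rightarrow> 'i \<Rightarrow> 'k" +
  fixes comult_G :: "'G \<Rightarrow> 'g \<Rightarrow> 'g \<Rightarrow> 'k" and counit_G :: "'G \<Rightarrow> 'k"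
    and antipode_G :: "'G \<Rightarrow> 'G"
    and x :: "'i \<Rightarrow> 'G"
    and pair :: "'G \<Rightarrow> 'g \<Rightarrow> 'k"
  assumes pair_bilinear: "bilinear_map scale_G scale_g (*) pair"
    and nondegenerate: "(\<And>Y. pair a Y = 0) \<Longrightarrow> a = 0"
    and dual_bases: "pair (x \<alpha>) (X \<beta>) = (if \<alpha> = \<beta> then 1 else 0)"
    and pair_mult: "pair (a * b) (X \<alpha>) =
      (\<Sum>(\<beta>, \<gamma>)\<in>{(\<beta>, \<gamma>). h \<beta> \<gamma> \<alpha> \<noteq> 0}. h \<beta> \<gamma> \<alpha> * (pair a (X \<beta>) * pair b (X \<gamma>)))"
    and pair_one: "pair 1 Y = counit Y"
    and pair_comult: "comult_G a Y Z = pair a (Y * Z)"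
    and pair_counit: "counit_G a = pair a 1"
    and pair_antipode: "pair (antipode_G a) Y = pair a (antipode Y)"
    and mult_basis_G: "formal_sum pair x (h \<alpha> \<beta>) (x \<alpha> * x \<beta>)"
    and comult_basis_G:
      "formal_sum (\<lambda>B (Y, Z). B Y Z) (\<lambda>(\<beta>, \<gamma>) Y Z. pair (x \<beta>) Y * pair (x \<gamma>) Z)
        (\<lambda>(\<beta>, \<gamma>). f \<beta> \<gamma> \<alpha>) (comult_G (x \<alpha>))"


section \<open>Representations labelled by spins\<close>

definition spin :: "rat \<Rightarrow> bool"
  where "spin j \<longleftrightarrow> (\<exists>n::nat. j = of_nat n / 2)"

definition weights :: "rat \<Rightarrow> rat set"
  where "weights j = {m. \<exists>k::nat. m = - j + of_nat k \<and> m \<le> j}"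

definition coupled_spins :: "rat \<Rightarrow> rat \<Rightarrow> rat set"
  where "coupled_spins j1 j2 = {j. \<exists>k::nat. j = \<bar>j1 - j2\<bar> + of_nat k \<and> j \<le> j1 + j2}"

definition spin_space ::
  "('k::field \<Rightarrow> 'v::ab_group_add \<Rightarrow> 'v) \<Rightarrow> (rat \<Rightarrow> rat \<Rightarrow> 'v) \<Rightarrow> rat \<Rightarrow> 'v set"
  where "spin_space s ket j = module.span s (ket j ` weights j)"

definition tensor_space ::
  "('k::field \<Rightarrow> 'w::ab_group_add \<Rightarrow> 'w) \<Rightarrow> ('v \<Rightarrow> 'v \<Rightarrow> 'w) \<Rightarrow> 'v set \<Rightarrow> 'v set \<Rightarrow> 'w set"
  where "tensor_space s t A B = module.span s {t a b |a b. a \<in> A \<and> b \<in> B}"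

text \<open>The spin representations are submodules of one ambient module \<open>'v\<close> (for instance their
  direct sum), and \<open>'w\<close> is the tensor square of \<open>'v\<close>, on which \<open>'g\<close> acts through its coproduct.
  For each \<open>j\<close> in \<open>coupled_spins j1 j2\<close> the map \<open>emb j1 j2 j\<close> identifies the spin-\<open>j\<close>
  representation with the spin-\<open>j\<close> component of the tensor product of the representations \<open>j1\<close>
  and \<open>j2\<close>; only its restriction to the spin-\<open>j\<close> representation matters. Likewise \<open>bra j m\<close> is
  a linear form on \<open>'v\<close> of which only the restriction to the spin-\<open>j\<close> representation matters.\<close>

locale spin_representations =
  dual_hopf_algebras scale_G scale_g scale_gg tens comult counit antipode X f h
    comult_G counit_G antipode_G x pair +
  VV: tensor_product scale_v scale_v scale_w tens_v
  for scale_G :: "'k::field \<Rightarrow> 'G::ring_1 \<Rightarrow> 'G"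
    and scale_g :: "'k \<Rightarrow> 'g::ring_1 \<Rightarrow> 'g"
    and scale_gg :: "'k \<Rightarrow> 'gg::ring_1 \<Rightarrow> 'gg"
    and tens :: "'g \<Rightarrow> 'g \<Rightarrow> 'gg"
    and comult :: "'g \<Rightarrow> 'gg" and counit :: "'g \<Rightarrow> 'k" and antipode :: "'g \<Rightarrow> 'g"
    and X :: "'i \<Rightarrow> 'g"
    and f :: "'i \<Rightarrow> 'i \<Rightarrow> 'i \<Rightarrow> 'k" and h :: "'i \<Rightarrow> 'i \<Rightarrow> 'i \<Rightarrow> 'k"
    and comult_G :: "'G \<Rightarrow> 'g \<Rightarrow> 'g \<Rightarrow> 'k" and counit_G :: "'G \<Rightarrow> 'k"
    and antipode_G :: "'G \<Rightarrow> 'G"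
    and x :: "'i \<Rightarrow> 'G"
    and pair :: "'G \<Rightarrow> 'g \<Rightarrow> 'k"
    and scale_v :: "'k \<Rightarrow> 'v::ab_group_add \<Rightarrow> 'v"
    and scale_w :: "'k \<Rightarrow> 'w::ab_group_add \<Rightarrow> 'w"
    and tens_v :: "'v \<Rightarrow> 'v \<Rightarrow> 'w" +
  fixes act :: "'g \<Rightarrow> 'v \<Rightarrow> 'v"
    and ket :: "rat \<Rightarrow> rat \<Rightarrow> 'v"
    and bra :: "rat \<Rightarrow> rat \<Rightarrow> 'v \<Rightarrow> 'k"
    and act_w :: "'g \<Rightarrow> 'w \<Rightarrow> 'w"
    and emb :: "rat \<Rightarrow> rat \<Rightarrow> rat \<Rightarrow> 'v \<Rightarrow> 'w"
  assumes act_bilinear: "bilinear_map scale_g scale_v scale_v act"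
    and act_one: "act 1 v = v"
    and act_mult: "act (a * b) v = act a (act b v)"
    and act_invariant: "spin j \<Longrightarrow> v \<in> spin_space scale_v ket j \<Longrightarrow>
      act a v \<in> spin_space scale_v ket j"
    and bra_linear: "spin j \<Longrightarrow> m \<in> weights j \<Longrightarrow> Vector_Spaces.linear scale_v (*) (bra j m)"
    and orthonormal: "spin j \<Longrightarrow> m' \<in> weights j \<Longrightarrow> m \<in> weights j \<Longrightarrow>
      bra j m' (ket j m) = (if m' = m then 1 else 0)"
    and complete: "spin j \<Longrightarrow> v \<in> spin_space scale_v ket j \<Longrightarrow>
      (\<Sum>m\<in>weights j. scale_v (bra j m v) (ket j m)) = v"
    and irreducible: "spin j \<Longrightarrow> VV.A.subspace U \<Longrightarrow> U \<subseteq> spin_space scale_v ket j \<Longrightarrow>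
      (\<And>a u. u \<in> U \<Longrightarrow> act a u \<in> U) \<Longrightarrow> U = {0} \<or> U = spin_space scale_v ket j"
    and act_w_bilinear: "bilinear_map scale_g scale_w scale_w act_w"
    and act_w_tens: "act_w (X \<alpha>) (tens_v v w) =
      (\<Sum>(\<beta>, \<gamma>)\<in>{(\<beta>, \<gamma>). h \<beta> \<gamma> \<alpha> \<noteq> 0}.
        scale_w (h \<beta> \<gamma> \<alpha>) (tens_v (act (X \<beta>) v) (act (X \<gamma>) w)))"
    and emb_linear: "spin j1 \<Longrightarrow> spin j2 \<Longrightarrow> j \<in> coupled_spins j1 j2 \<Longrightarrow>
      Vector_Spaces.linear scale_v scale_w (emb j1 j2 j)"
    and emb_inj: "spin j1 \<Longrightarrow> spin j2 \<Longrightarrow> j \<in> coupled_spins j1 j2 \<Longrightarrow>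
      inj_on (emb j1 j2 j) (spin_space scale_v ket j)"
    and emb_equivariant: "spin j1 \<Longrightarrow> spin j2 \<Longrightarrow> j \<in> coupled_spins j1 j2 \<Longrightarrow>
      v \<in> spin_space scale_v ket j \<Longrightarrow> emb j1 j2 j (act a v) = act_w a (emb j1 j2 j v)"
    and completely_reducible: "spin j1 \<Longrightarrow> spin j2 \<Longrightarrow>
      VV.C.internal_direct_sum (coupled_spins j1 j2) (\<lambda>j. emb j1 j2 j ` spin_space scale_v ket j)
        (tensor_space scale_w tens_v (spin_space scale_v ket j1) (spin_space scale_v ket j2))"

end

theory Submission
  imports Defs
begin

text \<open>Pairing a product of \<open>D\<close>-functions with \<open>X\<^sub>\<alpha>\<close> gives, because the multiplication of the function
  algebra is dual to the coproduct, a matrix element of \<open>X\<^sub>\<alpha>\<close> on the tensor product representation in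
  the uncoupled basis \<open>|j\<^sub>1 m\<^sub>1\<rangle> \<otimes> |j\<^sub>2 m\<^sub>2\<rangle>\<close> (lemma \<open>act_w_tens_ket\<close>). In the coupled basis
  \<open>|(j\<^sub>1 j\<^sub>2) j m\<rangle>\<close> the same operator is block diagonal: by equivariance of the embeddings, the block
  of spin \<open>j\<close> is the matrix of \<open>X\<^sub>\<alpha>\<close> on the spin-\<open>j\<close> representation, whose entries are the pairings
  of \<open>D\<^sup>j\<close> with \<open>X\<^sub>\<alpha>\<close>, and the other blocks vanish (lemma \<open>act_w_coupled_ket\<close>). The coefficients \<open>\<Omega>\<close>
  and \<open>\<mho>\<close> are the two transition matrices between these bases. So the identity, paired with
  \<open>X\<^sub>\<alpha>\<close>, is the change-of-basis formula for one operator. Comparing coefficients is legitimate because the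
  coupled vectors are linearly independent (lemma \<open>coupled_coefficients_unique\<close>), and the pairings with
  all \<open>X\<^sub>\<alpha>\<close> determine an element of the function algebra (lemma \<open>eq_if_pair_basis_eq\<close>).\<close>

section \<open>Spins and weights\<close>

lemma finite_weights: "finite (weights j)"
proof (rule finite_subset)
  show "weights j \<subseteq> (\<lambda>k::nat. - j + of_nat k) ` {.. nat \<lfloor>2 * j\<rfloor>}"
  proof
    fix m assume "m \<in> weights j"
    then obtain k :: nat where k: "m = - j + of_nat k" "m \<le> j"
      unfolding weights_def by blast
    then have "of_int (int k) \<le> 2 * j" by simp
    then have "int k \<le> \<lfloor>2 * j\<rfloor>" by (simp only: le_floor_iff)
    then show "m \<in> (\<lambda>k::nat. - j + of_nat k) ` {.. nat \<lfloor>2 * j\<rfloor>}"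
      using k(1) by auto
  qed
qed simp

lemma finite_coupled_spins: "finite (coupled_spins j1 j2)"
proof (rule finite_subset)
  let ?I = "(\<lambda>k::nat. \<bar>j1 - j2\<bar> + of_nat k) ` {.. nat \<lfloor>j1 + j2\<rfloor>}"
  show "coupled_spins j1 j2 \<subseteq> ?I"
  proof
    fix j assume "j \<in> coupled_spins j1 j2"
    then obtain k :: nat where k: "j = \<bar>j1 - j2\<bar> + of_nat k" "j \<le> j1 + j2"
      unfolding coupled_spins_def by blast
    then have "of_int (int k) \<le> j1 + j2" by simp
    then have "int k \<le> \<lfloor>j1 + j2\<rfloor>" by (simp only: le_floor_iff)
    then show "j \<in> ?I" using k(1) by auto
  qed
qed simp

lemma spin_coupled:
  assumes "spin j1" "spin j2" "j \<in> coupled_spins j1 j2"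
  shows "spin j"
proof -
  obtain a b k :: nat where abk: "j1 = of_nat a / 2" "j2 = of_nat b / 2" "j = \<bar>j1 - j2\<bar> + of_nat k"
    using assms unfolding spin_def coupled_spins_def by blast
  \<comment> \<open>One of the two truncated differences is zero, so their sum is \<open>\<bar>a - b\<bar>\<close>.\<close>
  have "j = of_nat ((a - b) + (b - a) + 2 * k) / 2"
  proof (cases "a \<le> b")
    case True
    then show ?thesis using abk by (simp add: of_nat_diff abs_if diff_divide_distrib add_divide_distrib)
  next
    case False
    then show ?thesis using abk by (simp add: of_nat_diff abs_if diff_divide_distrib add_divide_distrib)
  qed
  then show ?thesis unfolding spin_def by blast
qed

section \<open>Pairing with the basis of the enveloping algebra\<close>

lemma (in dual_hopf_algebras) eq_if_pair_basis_eq: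
  assumes "\<And>\<alpha>. pair a (X \<alpha>) = pair b (X \<alpha>)"
  shows "a = b"
proof -
  interpret L: Vector_Spaces.linear scale_G "(*)" "\<lambda>a. pair a Y" for Y
    using pair_bilinear unfolding bilinear_map_def by blast
  interpret R: Vector_Spaces.linear scale_g "(*)" "pair (a - b)"
    using pair_bilinear unfolding bilinear_map_def by blast
  have "pair (a - b) Y = 0" for Y
    by (rule R.eq_0_on_span[of "range X"]) (auto simp: L.diff assms g.basis_span)
  then show ?thesis using nondegenerate[of "a - b"] by simp
qed

text \<open>Only the \<open>\<alpha>\<close> term of the formal sum pairs nontrivially with \<open>X\<^sub>\<alpha>\<close>. For a \<open>D\<close>-function this
  turns the formal definition into a genuine matrix element.\<close>

lemma (in dual_hopf_algebras) pair_formal_sum_basis: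
  assumes "formal_sum pair x c a"
  shows "pair a (X \<alpha>) = c \<alpha>"
proof -
  have "{i. c i * pair (x i) (X \<alpha>) \<noteq> 0} = (if c \<alpha> = 0 then {} else {\<alpha>})"
    by (auto simp: dual_bases split: if_splits)
  then show ?thesis
    using assms unfolding formal_sum_def by (simp add: dual_bases)
qed

section \<open>Tensor products of spin representations\<close>

lemma linear_combination_image:
  assumes "Vector_Spaces.linear s1 s2 g"
  shows "g (\<Sum>i\<in>I. s1 (c i) (v i)) = (\<Sum>i\<in>I. s2 (c i) (g (v i)))"
proof -
  interpret g: Vector_Spaces.linear s1 s2 g by (fact assms)
  show ?thesis by (simp add: g.sum g.scale)
qed

context spin_representations
begin

lemma ket_in_spin_space: "m \<in> weights j \<Longrightarrow> ket j m \<in> spin_space scale_v ket j"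
  unfolding spin_space_def by (intro VV.A.span_base) blast

lemma act_ket_expansion:
  assumes "spin j" "m \<in> weights j"
  shows "act a (ket j m) = (\<Sum>k\<in>weights j. scale_v (bra j k (act a (ket j m))) (ket j k))"
  using assms by (simp add: complete act_invariant ket_in_spin_space)

text \<open>A vector of the tensor product has only one decomposition into its spin components. Within the
  component of spin \<open>j\<close>, the embedding is injective and the forms \<open>\<langle>j m|\<close> read off the coordinates.\<close>

lemma coupled_coefficients_unique:
  assumes spins: "spin j1" "spin j2"
    and eq: "(\<Sum>j\<in>coupled_spins j1 j2. \<Sum>m\<in>weights j. scale_w (c j m) (emb j1 j2 j (ket j m))) =
      (\<Sum>j\<in>coupled_spins j1 j2. \<Sum>m\<in>weights j. scale_w (d j m) (emb j1 j2 j (ket j m)))"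
    and j: "j \<in> coupled_spins j1 j2" and m: "m \<in> weights j"
  shows "c j m = d j m"
proof -
  let ?J = "coupled_spins j1 j2" and ?S = "spin_space scale_v ket"
  let ?W = "tensor_space scale_w tens_v (?S j1) (?S j2)"
  define vec where "vec c j = (\<Sum>m\<in>weights j. scale_v (c j m) (ket j m))" for c j
  \<comment> \<open>Uniqueness of the decomposition is stated for functions that vanish outside \<open>?J\<close>.\<close>
  define comp where "comp c j = (if j \<in> ?J then emb j1 j2 j (vec c j) else 0)" for c j
  have vec_in: "vec c j \<in> ?S j" for c j
    unfolding vec_def spin_space_def
    by (intro VV.A.span_sum VV.A.span_scale VV.A.span_base imageI)
  have emb_vec: "emb j1 j2 i (vec c i) = (\<Sum>m\<in>weights i. scale_w (c i m) (emb j1 j2 i (ket i m)))"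
    if "i \<in> ?J" for c i
    unfolding vec_def by (rule linear_combination_image[OF emb_linear[OF spins that]])
  note dsum = completely_reducible[OF spins, unfolded VV.C.internal_direct_sum_def]
  have comp_in: "comp c i \<in> emb j1 j2 i ` ?S i" if "i \<in> ?J" for c i
    using that vec_in by (simp add: comp_def)
  have comp_sum: "sum (comp c) ?J =
      (\<Sum>j\<in>?J. \<Sum>m\<in>weights j. scale_w (c j m) (emb j1 j2 j (ket j m)))" for c
    by (rule sum.cong) (simp_all add: comp_def emb_vec)
  have "comp c i \<in> ?W" if "i \<in> ?J" for i
    by (rule subsetD[OF conjunct2[OF bspec[OF conjunct1[OF dsum] that]] comp_in[OF that]])
  then have "sum (comp c) ?J \<in> ?W"
    unfolding tensor_space_def by (rule VV.C.span_sum)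
  from bspec[OF conjunct2[OF dsum] this]
  obtain u where unique: "\<And>u'. (\<forall>i\<in>?J. u' i \<in> emb j1 j2 i ` ?S i) \<and>
      (\<forall>i. i \<notin> ?J \<longrightarrow> u' i = 0) \<and> sum (comp c) ?J = sum u' ?J \<Longrightarrow> u' = u"
    by (elim ex1E) (rule that, erule allE, erule mp)
  have "comp e = u" if "sum (comp c) ?J = sum (comp e) ?J" for e
    by (intro unique conjI ballI allI impI comp_in that) (simp_all only: comp_def if_False)
  moreover have "sum (comp c) ?J = sum (comp d) ?J"
    using eq by (simp only: comp_sum)
  ultimately have "comp c = u" and "comp d = u"
    by (iprover intro: refl)+
  then have "comp c j = comp d j" by simp
  then have "emb j1 j2 j (vec c j) = emb j1 j2 j (vec d j)"
    using j by (simp add: comp_def)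
  then have vec_eq: "vec c j = vec d j"
    by (rule inj_onD[OF emb_inj[OF spins j] _ vec_in vec_in])
  have spin_j: "spin j" by (rule spin_coupled[OF spins j])
  have "bra j m (vec c j) = c j m" for c
  proof -
    have "bra j m (vec c j) = (\<Sum>k\<in>weights j. c j k * bra j m (ket j k))"
      unfolding vec_def by (rule linear_combination_image[OF bra_linear[OF spin_j m]])
    also have "\<dots> = (\<Sum>k\<in>weights j. if m = k then c j k else 0)"
      by (rule sum.cong) (simp_all add: orthonormal[OF spin_j m])
    finally show ?thesis using m by (simp add: finite_weights)
  qed
  from this[of c] this[of d] show ?thesis by (simp add: vec_eq)
qed

text \<open>The same \<open>h\<close> gives the coproduct of \<open>X\<^sub>\<alpha>\<close> and the product of functions, so the matrix
  elements of \<open>X\<^sub>\<alpha>\<close> on a tensor product are pairings with products. The families \<open>a\<close> and \<open>b\<close> stand for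
  the columns \<open>m\<^sub>1\<close> and \<open>m\<^sub>2\<close> of the \<open>D\<close>-functions of spin \<open>j\<^sub>1\<close> and \<open>j\<^sub>2\<close>.\<close>

lemma act_w_tens_ket:
  assumes D1: "\<And>k \<beta>. k \<in> weights j1 \<Longrightarrow> pair (a k) (X \<beta>) = bra j1 k (act (X \<beta>) (ket j1 m1))"
    and D2: "\<And>k \<beta>. k \<in> weights j2 \<Longrightarrow> pair (b k) (X \<beta>) = bra j2 k (act (X \<beta>) (ket j2 m2))"
    and spins: "spin j1" "spin j2" and m: "m1 \<in> weights j1" "m2 \<in> weights j2"
  shows "act_w (X \<alpha>) (tens_v (ket j1 m1) (ket j2 m2)) =
    (\<Sum>k1\<in>weights j1. \<Sum>k2\<in>weights j2.
      scale_w (pair (a k1 * b k2) (X \<alpha>)) (tens_v (ket j1 k1) (ket j2 k2)))"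
proof -
  let ?H = "{(\<beta>, \<gamma>). h \<beta> \<gamma> \<alpha> \<noteq> 0}"
  let ?T = "\<lambda>k1 k2. tens_v (ket j1 k1) (ket j2 k2)"
  have lin_left: "Vector_Spaces.linear scale_v scale_w (\<lambda>v. tens_v v w)"
    and lin_right: "Vector_Spaces.linear scale_v scale_w (tens_v v)" for v w
    using VV.bilinear unfolding bilinear_map_def by blast+
  have factor: "tens_v (act (X \<beta>) (ket j1 m1)) (act (X \<gamma>) (ket j2 m2)) =
      (\<Sum>k1\<in>weights j1. \<Sum>k2\<in>weights j2. scale_w (pair (a k1) (X \<beta>) * pair (b k2) (X \<gamma>)) (?T k1 k2))"
    for \<beta> \<gamma>
  proof -
    have 1: "act (X \<beta>) (ket j1 m1) = (\<Sum>k\<in>weights j1. scale_v (pair (a k) (X \<beta>)) (ket j1 k))"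
      using act_ket_expansion[OF spins(1) m(1)] by (simp add: D1)
    have 2: "act (X \<gamma>) (ket j2 m2) = (\<Sum>k\<in>weights j2. scale_v (pair (b k) (X \<gamma>)) (ket j2 k))"
      using act_ket_expansion[OF spins(2) m(2)] by (simp add: D2)
    show ?thesis
      unfolding 1 2 linear_combination_image[OF lin_left] linear_combination_image[OF lin_right]
      by (subst sum.swap) (simp add: VV.C.scale_sum_right mult.commute)
  qed
  have "act_w (X \<alpha>) (?T m1 m2) = (\<Sum>(\<beta>, \<gamma>)\<in>?H. \<Sum>k1\<in>weights j1. \<Sum>k2\<in>weights j2.
      scale_w (h \<beta> \<gamma> \<alpha> * (pair (a k1) (X \<beta>) * pair (b k2) (X \<gamma>))) (?T k1 k2))"
    unfolding act_w_tens factor by (simp only: VV.C.scale_sum_right VV.C.scale_scale)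
  also have "\<dots> = (\<Sum>k1\<in>weights j1. \<Sum>k2\<in>weights j2. \<Sum>(\<beta>, \<gamma>)\<in>?H.
      scale_w (h \<beta> \<gamma> \<alpha> * (pair (a k1) (X \<beta>) * pair (b k2) (X \<gamma>))) (?T k1 k2))"
    unfolding case_prod_beta
    by (subst sum.swap, rule sum.cong[OF refl], rule sum.swap)
  also have "\<dots> = (\<Sum>k1\<in>weights j1. \<Sum>k2\<in>weights j2. scale_w (pair (a k1 * b k2) (X \<alpha>)) (?T k1 k2))"
    unfolding pair_mult VV.C.scale_sum_left by (intro sum.cong refl) auto
  finally show ?thesis .
qed

text \<open>The Kronecker delta, which pads the single block of spin \<open>j\<close> to an expansion in the whole coupled
  basis, becomes the \<open>\<delta>\<close> of the identity for the \<open>D\<close>-functions.\<close>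

lemma act_w_coupled_ket:
  assumes spins: "spin j1" "spin j2" and j: "j \<in> coupled_spins j1 j2" and m: "m \<in> weights j"
  shows "act_w a (emb j1 j2 j (ket j m)) =
    (\<Sum>i\<in>coupled_spins j1 j2. \<Sum>k\<in>weights i.
      scale_w ((if j = i then 1 else 0) * bra i k (act a (ket j m))) (emb j1 j2 i (ket i k)))"
proof -
  have "act_w a (emb j1 j2 j (ket j m)) = emb j1 j2 j (act a (ket j m))"
    using emb_equivariant[OF spins j ket_in_spin_space[OF m]] by simp
  also have "\<dots> = (\<Sum>k\<in>weights j. scale_w (bra j k (act a (ket j m))) (emb j1 j2 j (ket j k)))"
    by (subst act_ket_expansion[OF spin_coupled[OF spins j] m])
      (rule linear_combination_image[OF emb_linear[OF spins j]])
  also have "\<dots> = (\<Sum>i\<in>coupled_spins j1 j2. if j = i then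
      (\<Sum>k\<in>weights i. scale_w (bra i k (act a (ket j m))) (emb j1 j2 i (ket i k))) else 0)"
    using j by (simp add: finite_coupled_spins)
  also have "\<dots> = (\<Sum>i\<in>coupled_spins j1 j2. \<Sum>k\<in>weights i.
      scale_w ((if j = i then 1 else 0) * bra i k (act a (ket j m))) (emb j1 j2 i (ket i k)))"
    by (rule sum.cong) simp_all
  finally show ?thesis .
qed

end

section \<open>Comparing the two bases\<close>

theorem theorem3p1:
  fixes scale_G :: "'k::field \<Rightarrow> 'G::ring_1 \<Rightarrow> 'G"
    and scale_g :: "'k \<Rightarrow> 'g::ring_1 \<Rightarrow> 'g"
    and scale_gg :: "'k \<Rightarrow> 'gg::ring_1 \<Rightarrow> 'gg"
    and scale_v :: "'k \<Rightarrow> 'v::ab_group_add \<Rightarrow> 'v"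
    and scale_w :: "'k \<Rightarrow> 'w::ab_group_add \<Rightarrow> 'w"
    and x :: "'i \<Rightarrow> 'G" and X :: "'i \<Rightarrow> 'g"
    and D :: "rat \<Rightarrow> rat \<Rightarrow> rat \<Rightarrow> 'G"
    and \<Omega> mho :: "rat \<Rightarrow> rat \<Rightarrow> rat \<Rightarrow> rat \<Rightarrow> rat \<Rightarrow> rat \<Rightarrow> 'k"
  assumes setting: "spin_representations scale_G scale_g scale_gg tens comult counit antipode X f h
      comult_G counit_G antipode_G x pair scale_v scale_w tens_v act ket bra act_w emb"
    and D_function: "\<And>j m' m. spin j \<Longrightarrow> m' \<in> weights j \<Longrightarrow> m \<in> weights j \<Longrightarrow>
      formal_sum pair x (\<lambda>\<alpha>. bra j m' (act (X \<alpha>) (ket j m))) (D j m' m)"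
    and Omega_expansion: "\<And>j1 j2 j m. spin j1 \<Longrightarrow> spin j2 \<Longrightarrow> j \<in> coupled_spins j1 j2 \<Longrightarrow> m \<in> weights j \<Longrightarrow>
      emb j1 j2 j (ket j m) =
        (\<Sum>m1\<in>weights j1. \<Sum>m2\<in>weights j2.
          scale_w (\<Omega> j1 j2 j m1 m2 m) (tens_v (ket j1 m1) (ket j2 m2)))"
    and mho_expansion: "\<And>j1 j2 m1 m2. spin j1 \<Longrightarrow> spin j2 \<Longrightarrow> m1 \<in> weights j1 \<Longrightarrow> m2 \<in> weights j2 \<Longrightarrow>
      tens_v (ket j1 m1) (ket j2 m2) =
        (\<Sum>j\<in>coupled_spins j1 j2. \<Sum>m\<in>weights j.
          scale_w (mho j1 j2 j m1 m2 m) (emb j1 j2 j (ket j m)))"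
    and "spin j1" and "spin j2"
    and "j \<in> coupled_spins j1 j2" and "j' \<in> coupled_spins j1 j2"
    and "m \<in> weights j" and "m' \<in> weights j'"
  shows "scale_G (if j = j' then 1 else 0) (D j m' m) =
    (\<Sum>k1\<in>weights j1. \<Sum>k2\<in>weights j2. \<Sum>m1\<in>weights j1. \<Sum>m2\<in>weights j2.
      scale_G (mho j1 j2 j' k1 k2 m' * \<Omega> j1 j2 j m1 m2 m) (D j1 k1 m1 * D j2 k2 m2))"
proof -
  interpret spin_representations scale_G scale_g scale_gg tens comult counit antipode X f h
    comult_G counit_G antipode_G x pair scale_v scale_w tens_v act ket bra act_w emb
    by (fact setting)
  note spins = \<open>spin j1\<close> \<open>spin j2\<close> and j = \<open>j \<in> coupled_spins j1 j2\<close> and m = \<open>m \<in> weights j\<close>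
  have pair_D: "pair (D i k' k) (X \<alpha>) = bra i k' (act (X \<alpha>) (ket i k))"
    if "spin i" "k' \<in> weights i" "k \<in> weights i" for i k' k \<alpha>
    by (rule pair_formal_sum_basis[OF D_function[OF that]])
  interpret P: Vector_Spaces.linear scale_G "(*)" "\<lambda>a. pair a Y" for Y
    using pair_bilinear unfolding bilinear_map_def by blast
  interpret A: Vector_Spaces.linear scale_w scale_w "act_w a" for a
    using act_w_bilinear unfolding bilinear_map_def by blast
  let ?J = "coupled_spins j1 j2" and ?W1 = "weights j1" and ?W2 = "weights j2"
  show ?thesis
  proof (rule eq_if_pair_basis_eq)
    fix \<alpha>
    define M where "M k1 k2 m1 m2 = pair (D j1 k1 m1 * D j2 k2 m2) (X \<alpha>)" for k1 k2 m1 m2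
    define c where "c i k = (\<Sum>k1\<in>?W1. \<Sum>k2\<in>?W2. \<Sum>m1\<in>?W1. \<Sum>m2\<in>?W2.
      mho j1 j2 i k1 k2 k * \<Omega> j1 j2 j m1 m2 m * M k1 k2 m1 m2)" for i k
    define E where "E i k = emb j1 j2 i (ket i k)" for i k
    \<comment> \<open>From the coupled basis to the uncoupled one by \<open>\<Omega>\<close>, the action of \<open>X\<^sub>\<alpha>\<close> there, and back by \<open>\<mho>\<close>:
      \<open>c i k\<close>, the sum for \<open>j' = i\<close> and \<open>m' = k\<close> paired with \<open>X\<^sub>\<alpha>\<close>, appears as a coordinate of \<open>X\<^sub>\<alpha> |(j\<^sub>1 j\<^sub>2) j m\<rangle>\<close>.\<close>
    have "act_w (X \<alpha>) (E j m) = (\<Sum>m1\<in>?W1. \<Sum>m2\<in>?W2.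
        scale_w (\<Omega> j1 j2 j m1 m2 m) (act_w (X \<alpha>) (tens_v (ket j1 m1) (ket j2 m2))))"
      unfolding E_def Omega_expansion[OF spins j m] by (simp add: A.sum A.scale)
    also have "\<dots> = (\<Sum>m1\<in>?W1. \<Sum>m2\<in>?W2. scale_w (\<Omega> j1 j2 j m1 m2 m)
        (\<Sum>k1\<in>?W1. \<Sum>k2\<in>?W2. scale_w (M k1 k2 m1 m2) (tens_v (ket j1 k1) (ket j2 k2))))"
    proof (intro sum.cong refl arg_cong[where f = "scale_w _"])
      fix m1 m2 assume "m1 \<in> ?W1" "m2 \<in> ?W2"
      then show "act_w (X \<alpha>) (tens_v (ket j1 m1) (ket j2 m2)) =
          (\<Sum>k1\<in>?W1. \<Sum>k2\<in>?W2. scale_w (M k1 k2 m1 m2) (tens_v (ket j1 k1) (ket j2 k2)))"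
        unfolding M_def by (intro act_w_tens_ket spins pair_D)
    qed
    also have "\<dots> = (\<Sum>m1\<in>?W1. \<Sum>m2\<in>?W2. scale_w (\<Omega> j1 j2 j m1 m2 m)
        (\<Sum>k1\<in>?W1. \<Sum>k2\<in>?W2. scale_w (M k1 k2 m1 m2)
          (\<Sum>i\<in>?J. \<Sum>k\<in>weights i. scale_w (mho j1 j2 i k1 k2 k) (E i k))))"
      by (simp add: mho_expansion[OF spins] E_def)
    also have "\<dots> = (\<Sum>m1\<in>?W1. \<Sum>m2\<in>?W2. \<Sum>k1\<in>?W1. \<Sum>k2\<in>?W2. \<Sum>i\<in>?J. \<Sum>k\<in>weights i.
        scale_w (mho j1 j2 i k1 k2 k * \<Omega> j1 j2 j m1 m2 m * M k1 k2 m1 m2) (E i k))"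
      by (simp only: VV.C.scale_sum_right VV.C.scale_scale mult_ac)
    \<comment> \<open>Grouping each index pair makes the reversal of the summation order three interchanges.\<close>
    also have "\<dots> = (\<Sum>(m1, m2)\<in>?W1 \<times> ?W2. \<Sum>(k1, k2)\<in>?W1 \<times> ?W2. \<Sum>(i, k)\<in>Sigma ?J weights.
        scale_w (mho j1 j2 i k1 k2 k * \<Omega> j1 j2 j m1 m2 m * M k1 k2 m1 m2) (E i k))"
      by (simp add: finite_coupled_spins finite_weights flip: sum.cartesian_product sum.Sigma)
    also have "\<dots> = (\<Sum>(i, k)\<in>Sigma ?J weights. \<Sum>(k1, k2)\<in>?W1 \<times> ?W2. \<Sum>(m1, m2)\<in>?W1 \<times> ?W2.
        scale_w (mho j1 j2 i k1 k2 k * \<Omega> j1 j2 j m1 m2 m * M k1 k2 m1 m2) (E i k))"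
      unfolding case_prod_unfold
      by (rule trans[OF sum.cong[OF refl sum.swap] trans[OF sum.swap sum.cong[OF refl sum.swap]]])
    also have "\<dots> = (\<Sum>i\<in>?J. \<Sum>k\<in>weights i. scale_w (c i k) (E i k))"
      by (simp add: c_def VV.C.scale_sum_left finite_coupled_spins finite_weights
          flip: sum.cartesian_product sum.Sigma)
    finally have "(\<Sum>i\<in>?J. \<Sum>k\<in>weights i. scale_w (c i k) (emb j1 j2 i (ket i k))) =
        (\<Sum>i\<in>?J. \<Sum>k\<in>weights i. scale_w ((if j = i then 1 else 0) * bra i k (act (X \<alpha>) (ket j m)))
          (emb j1 j2 i (ket i k)))"
      using act_w_coupled_ket[OF spins j m] by (simp add: E_def)
    then have "c j' m' = (if j = j' then 1 else 0) * bra j' m' (act (X \<alpha>) (ket j m))"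
      by (rule coupled_coefficients_unique[OF spins _ \<open>j' \<in> ?J\<close> \<open>m' \<in> weights j'\<close>])
    also have "\<dots> = pair (scale_G (if j = j' then 1 else 0) (D j m' m)) (X \<alpha>)"
      using pair_D[OF spin_coupled[OF spins j] _ m] \<open>m' \<in> weights j'\<close>
      by (cases "j = j'") (simp_all add: P.scale)
    finally show "pair (scale_G (if j = j' then 1 else 0) (D j m' m)) (X \<alpha>) =
        pair (\<Sum>k1\<in>?W1. \<Sum>k2\<in>?W2. \<Sum>m1\<in>?W1. \<Sum>m2\<in>?W2.
          scale_G (mho j1 j2 j' k1 k2 m' * \<Omega> j1 j2 j m1 m2 m) (D j1 k1 m1 * D j2 k2 m2)) (X \<alpha>)"
      by (simp add: c_def M_def P.sum P.scale)
  qed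
qed

end
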